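(* Let $n \ge 2$ be an integer, let $U$ be a nonempty finite subset of $\mathbb{R}^n$, let $P \subset \mathbb{R}^n$ be a polytope containing $U$, and let $\epsilon > 0$. There exists a nonempty open set $\Sigma$ of finite $n$-player games such that, for every game $\Gamma \in \Sigma$, the set $NEP(\Gamma)$ of Nash equilibrium payoffs is $\epsilon$-close to $U$ and the set $CEP(\Gamma)$ of correlated equilibrium payoffs is $\epsilon$-close to $P$.
   Context: A polytope in $\mathbb{R}^n$ is the convex hull of a finite set of points. A (finite) $n$-player game $G$ consists of a nonempty finite pure strategy set $S_i$ and a payoff function $u_i : S := S_1 \times \cdots \times S_n \to \mathbb{R}$ for each player $i \in \{1,\dots,n\}$. Write $S_{-i} := \prod_{j \ne i} S_j$. A correlated equilibrium of $G$ is a probability distribution $\mu$ on $S$ such that for every player $i$ and all $s_i, t_i \in S_i$, $\sum_{s_{-i} \in S_{-i}} \mu(s_i,s_{-i})\,[u_i(s_i,s_{-i}) - u_i(t_i,s_{-i})] \ge 0$. For a probability distribution $\mu$ on $S$, $u_i(\mu) := \sum_{s \in S} \mu(s) u_i(s)$. $CEP(G) \subset \mathbb{R}^n$ denotes the set of all vectors $(u_1(\mu),\dots,u_n(\mu))$ where $\mu$ is a correlated equilibrium of $G$. $NEP(G) \subset \mathbb{R}^n$ denotes the set of all vectors of expected payoffs of (mixed) Nash equilibria of $G$. For $x \in \mathbb{R}^n$, $\|x\| := \max_{1 \le i \le n} |x_i|$. Two subsets $A, A' \subset \mathbb{R}^n$ are $\epsilon$-close if for every $x \in A$ there is $x' \in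 A'$ with $\|x - x'\| < \epsilon$, and for every $x' \in A'$ there is $x \in A$ with $\|x - x'\| < \epsilon$. For a finite game $G$ with payoff functions $u_i$ and $\alpha > 0$, the open ball $B(G,\alpha)$ is the set of all games $G'$ with the same sets of players and pure strategies as $G$ whose payoff functions $u'_i$ satisfy $|u'_i(s) - u_i(s)| < \alpha$ for every player $i$ and every pure strategy profile $s$. A set $\Sigma$ of games is open if for every $G \in \Sigma$ there is $\alpha > 0$ with $B(G,\alpha) \subset \Sigma$. *)

theory Defs
  imports "HOL-Probability.Probability"
begin

record ('i, 's) game =
  strategies :: "'i \<Rightarrow> 's set"
  payoff :: "'i \<Rightarrow> ('i \<Rightarrow> 's) \<Rightarrow> real"

definition pure_profiles :: "('i, 's) game \<Rightarrow> ('i \<Rightarrow> 's) set" where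
  "pure_profiles G = Pi\<^sub>E UNIV (strategies G)"

text \<open>
  Payoff functions are \<open>undefined\<close> outside the pure strategy profiles, so that
  a game is determined by its strategy sets and by its payoffs on profiles.
\<close>

definition finite_game :: "('i::finite, 's) game \<Rightarrow> bool" where
  "finite_game G \<longleftrightarrow>
     (\<forall>i. finite (strategies G i) \<and> strategies G i \<noteq> {}
        \<and> payoff G i \<in> pure_profiles G \<rightarrow>\<^sub>E UNIV)"

definition expected_payoff :: "('i::finite, 's) game \<Rightarrow> 'i \<Rightarrow> ('i \<Rightarrow> 's) pmf \<Rightarrow> real" where
  "expected_payoff G i \<mu> = (\<Sum>s\<in>pure_profiles G. pmf \<mu> s * payoff G i s)"

definition correlated_equilibrium :: "('i::finite, 's) game \<Rightarrow> ('i \<Rightarrow> 's) pmf \<Rightarrow> bool" where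
  "correlated_equilibrium G \<mu> \<longleftrightarrow>
     set_pmf \<mu> \<subseteq> pure_profiles G \<and>
     (\<forall>i. \<forall>a\<in>strategies G i. \<forall>b\<in>strategies G i.
        (\<Sum>r\<in>Pi\<^sub>E (UNIV - {i}) (strategies G).
           pmf \<mu> (r(i := a)) * (payoff G i (r(i := a)) - payoff G i (r(i := b)))) \<ge> 0)"

text \<open>
  In \<open>product_distribution\<close> the default value of \<open>Pi_pmf\<close> plays no role, as
  the product ranges over all players.
\<close>

definition product_distribution :: "('i::finite \<Rightarrow> 's pmf) \<Rightarrow> ('i \<Rightarrow> 's) pmf" where
  "product_distribution \<sigma> = Pi_pmf UNIV undefined \<sigma>"

definition nash_equilibrium :: "('i::finite, 's) game \<Rightarrow> ('i \<Rightarrow> 's pmf) \<Rightarrow> bool" where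
  "nash_equilibrium G \<sigma> \<longleftrightarrow>
     (\<forall>i. set_pmf (\<sigma> i) \<subseteq> strategies G i) \<and>
     (\<forall>i \<tau>. set_pmf \<tau> \<subseteq> strategies G i \<longrightarrow>
        expected_payoff G i (product_distribution (\<sigma>(i := \<tau>)))
          \<le> expected_payoff G i (product_distribution \<sigma>))"

definition CEP :: "('i::finite, 's) game \<Rightarrow> (real ^ 'i) set" where
  "CEP G = {(\<chi> i. expected_payoff G i \<mu>) |\<mu>. correlated_equilibrium G \<mu>}"

definition NEP :: "('i::finite, 's) game \<Rightarrow> (real ^ 'i) set" where
  "NEP G = {(\<chi> i. expected_payoff G i (product_distribution \<sigma>)) |\<sigma>. nash_equilibrium G \<sigma>}"

text \<open>
  Closeness is measured in the maximum norm \<open>infnorm\<close>, not in the Euclidean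
  \<open>norm\<close> of the type \<open>real ^ 'i\<close>.
\<close>

definition eps_close :: "real \<Rightarrow> (real ^ 'i::finite) set \<Rightarrow> (real ^ 'i) set \<Rightarrow> bool" where
  "eps_close \<epsilon> A A' \<longleftrightarrow>
     (\<forall>x\<in>A. \<exists>x'\<in>A'. infnorm (x - x') < \<epsilon>) \<and>
     (\<forall>x'\<in>A'. \<exists>x\<in>A. infnorm (x - x') < \<epsilon>)"

definition game_ball :: "('i::finite, 's) game \<Rightarrow> real \<Rightarrow> ('i, 's) game set" where
  "game_ball G \<alpha> =
     {G'. finite_game G' \<and> strategies G' = strategies G \<and>
          (\<forall>i. \<forall>s\<in>pure_profiles G. \<bar>payoff G' i s - payoff G i s\<bar> < \<alpha>)}"

definition open_game_set :: "('i::finite, 's) game set \<Rightarrow> bool" where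
  "open_game_set \<S> \<longleftrightarrow>
     (\<forall>G\<in>\<S>. finite_game G) \<and> (\<forall>G\<in>\<S>. \<exists>\<alpha>>0. game_ball G \<alpha> \<subseteq> \<S>)"

end

theory Submission
  imports Defs
begin

text \<open>
  Two players are active and have the same strategies; every other player has a single one.
  The strategies are arranged in levels: one level with a single strategy for each point of
  \<open>U\<close>, and, above these, one block of six strategies for each vertex of \<open>P\<close>. At a profile
  in which nobody suffers a loss of 1, both players are at the same level and the payoff vector
  is the point of that level. All gains are of order \<open>\<delta>\<close>.

  Playing above the opponent costs 1, playing below costs only \<open>\<delta>\<close>. Hence a player can
  guarantee \<open>-\<delta>\<close> by descending to the bottom, so losses of 1 have probability of order
  \<open>\<delta>\<close> in every correlated equilibrium, whose payoff is therefore close to \<open>P\<close>; and in a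
  Nash equilibrium nearly all the mass lies on a single level. Each point of \<open>U\<close> is the payoff
  of a strict equilibrium.

  In a block, the first three strategies lose 1 on the diagonal only, so the uniform
  distribution off the diagonal is a strict correlated equilibrium at the vertex. A pair of
  independent strategies avoiding the diagonal must have a player who almost always plays one and
  the same strategy. The opponent then deviates to one of the last three strategies, which bet
  on a strategy of the first three and win \<open>4\<delta>\<close> or lose 1. So no Nash equilibrium lives in a
  block. All inequalities are strict and survive a perturbation of size \<open>\<delta> / 8\<close>.
\<close>

subsection \<open>Finite games\<close>

lemma finite_profiles_except:
  "finite_game G \<Longrightarrow> finite (Pi\<^sub>E (UNIV - {i}) (strategies G))"
  by (intro finite_PiE) (auto simp: finite_game_def)

lemma finite_pure_profiles: "finite_game G \<Longrightarrow> finite (pure_profiles G)"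
  unfolding pure_profiles_def by (intro finite_PiE) (auto simp: finite_game_def)

lemma sum_pure_profiles_split:
  fixes h :: "('i::finite \<Rightarrow> 's) \<Rightarrow> real"
  assumes "finite_game G"
  shows "(\<Sum>s\<in>pure_profiles G. h s) =
    (\<Sum>a\<in>strategies G i. \<Sum>r\<in>Pi\<^sub>E (UNIV - {i}) (strategies G). h (r(i := a)))"
proof -
  have "(\<Sum>a\<in>strategies G i. \<Sum>r\<in>Pi\<^sub>E (UNIV - {i}) (strategies G). h (r(i := a))) =
     (\<Sum>(a, r)\<in>strategies G i \<times> Pi\<^sub>E (UNIV - {i}) (strategies G). h (r(i := a)))"
    by (simp add: sum.cartesian_product)
  also have "\<dots> = (\<Sum>s\<in>pure_profiles G. h s)"
    by (rule sum.reindex_bij_witness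
          [where i = "\<lambda>s. (s i, restrict s (UNIV - {i}))" and j = "\<lambda>(a, r). r(i := a)"])
       (auto simp: pure_profiles_def PiE_def Pi_def extensional_def fun_eq_iff split: if_splits)
  finally show ?thesis by simp
qed

text \<open>The component \<open>\<sigma> i\<close> does not enter, so one quantity serves every
  strategy to which player \<open>i\<close> may switch.\<close>

definition deviation_payoff ::
    "('i::finite, 's) game \<Rightarrow> ('i \<Rightarrow> 's pmf) \<Rightarrow> 'i \<Rightarrow> 's \<Rightarrow> real" where
  "deviation_payoff G \<sigma> i a = (\<Sum>r\<in>Pi\<^sub>E (UNIV - {i}) (strategies G).
     (\<Prod>j\<in>UNIV - {i}. pmf (\<sigma> j) (r j)) * payoff G i (r(i := a)))"

lemma pmf_product_distribution:
  "pmf (product_distribution \<sigma>) s = (\<Prod>j\<in>UNIV. pmf (\<sigma> j) (s j))"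
  unfolding product_distribution_def by (subst pmf_Pi') auto

lemma expected_payoff_deviation:
  assumes "finite_game G"
  shows "expected_payoff G i (product_distribution (\<sigma>(i := \<tau>))) =
    (\<Sum>a\<in>strategies G i. pmf \<tau> a * deviation_payoff G \<sigma> i a)"
proof -
  have "pmf (product_distribution (\<sigma>(i := \<tau>))) (r(i := a)) =
      pmf \<tau> a * (\<Prod>j\<in>UNIV - {i}. pmf (\<sigma> j) (r j))" for r a
    unfolding pmf_product_distribution
    by (subst prod.remove[of _ i]) auto
  then show ?thesis
    unfolding expected_payoff_def deviation_payoff_def sum_pure_profiles_split[OF assms, of _ i]
    by (simp add: sum_distrib_left mult_ac)
qed

text \<open>The equilibrium payoff is the \<open>\<sigma> i\<close>-average of the deviation
  payoffs, none of which exceeds it; hence every strategy of the support attains it.\<close>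

lemma nash_equilibrium_best_reply:
  assumes G: "finite_game G" and "nash_equilibrium G \<sigma>"
    and a: "a \<in> set_pmf (\<sigma> i)" and b: "b \<in> strategies G i"
  shows "deviation_payoff G \<sigma> i b \<le> deviation_payoff G \<sigma> i a"
proof -
  let ?V = "deviation_payoff G \<sigma> i" and ?E = "expected_payoff G i (product_distribution \<sigma>)"
  have fin: "finite (strategies G i)" using G by (auto simp: finite_game_def)
  have sub: "set_pmf (\<sigma> i) \<subseteq> strategies G i"
    and dev: "set_pmf \<tau> \<subseteq> strategies G i \<Longrightarrow>
      expected_payoff G i (product_distribution (\<sigma>(i := \<tau>))) \<le> ?E" for \<tau>
    using assms(2) by (auto simp: nash_equilibrium_def)
  have le: "?V c \<le> ?E" if "c \<in> strategies G i" for c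
  proof -
    have "(\<Sum>d\<in>strategies G i. pmf (return_pmf c) d * ?V d) = ?V c"
      using fin that by (simp add: pmf_return indicator_def if_distrib cong: if_cong)
    then show ?thesis
      using dev[of "return_pmf c"] that by (simp add: expected_payoff_deviation[OF G])
  qed
  have E: "?E = (\<Sum>c\<in>strategies G i. pmf (\<sigma> i) c * ?V c)"
    using expected_payoff_deviation[OF G, of i \<sigma> "\<sigma> i"] by simp
  have "(\<Sum>c\<in>strategies G i. pmf (\<sigma> i) c * (?E - ?V c)) = 0"
    using E sum_pmf_eq_1[OF fin sub]
    by (simp add: right_diff_distrib sum_subtractf flip: sum_distrib_right)
  then have "pmf (\<sigma> i) a * (?E - ?V a) = 0"
    using a sub le fin by (subst (asm) sum_nonneg_eq_0_iff) auto
  then have "?V a = ?E" using a by (simp add: set_pmf_iff)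
  then show ?thesis using le[OF b] by simp
qed

section \<open>Openness of balls and general facts on equilibrium payoffs\<close>

lemma game_ball_open: "open_game_set (game_ball G \<alpha>)"
  unfolding open_game_set_def
proof (intro conjI ballI)
  fix H assume H: "H \<in> game_ball G \<alpha>"
  then show fin: "finite_game H" by (simp add: game_ball_def)
  have st: "pure_profiles H = pure_profiles G"
    using H by (auto simp: game_ball_def pure_profiles_def)
  \<comment> \<open>The finitely many margins left at \<open>H\<close>; the smallest serves as
    radius. The entry 1 makes nonemptiness immediate.\<close>
  define D where "D = insert 1 ((\<lambda>(i, s). \<alpha> - \<bar>payoff H i s - payoff G i s\<bar>) ` (UNIV \<times> pure_profiles G))"
  have D: "finite D" "D \<noteq> {}" using finite_pure_profiles[OF fin] by (auto simp: D_def st)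
  have "\<forall>d\<in>D. 0 < d" using H by (auto simp: D_def game_ball_def)
  then have "0 < Min D" using D by simp
  moreover have "game_ball H (Min D) \<subseteq> game_ball G \<alpha>"
  proof
    fix K assume K: "K \<in> game_ball H (Min D)"
    have "\<bar>payoff K i s - payoff G i s\<bar> < \<alpha>" if "s \<in> pure_profiles G" for i s
    proof -
      have "\<bar>payoff K i s - payoff H i s\<bar> < Min D" using K that by (auto simp: game_ball_def st)
      moreover have "Min D \<le> \<alpha> - \<bar>payoff H i s - payoff G i s\<bar>"
        using D that by (intro Min_le) (auto simp: D_def)
      ultimately show ?thesis by linarith
    qed
    then show "K \<in> game_ball G \<alpha>" using K H by (auto simp: game_ball_def)
  qed
  ultimately show "\<exists>\<beta>>0. game_ball H \<beta> \<subseteq> game_ball G \<alpha>" by blast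
qed

text \<open>The incentive constraints and the payoffs are linear in the distribution.\<close>

lemma convex_CEP: "convex (CEP (G :: ('i::finite, 's) game))"
  unfolding convex_alt
proof (intro ballI allI impI)
  fix x y :: "real ^ 'i" and u :: real
  assume "x \<in> CEP G" "y \<in> CEP G" and u: "0 \<le> u \<and> u \<le> 1"
  then obtain \<mu> \<nu> where \<mu>: "x = (\<chi> i. expected_payoff G i \<mu>)" "correlated_equilibrium G \<mu>"
    and \<nu>: "y = (\<chi> i. expected_payoff G i \<nu>)" "correlated_equilibrium G \<nu>"
    unfolding CEP_def by blast
  \<comment> \<open>The coin shows True with probability \<open>u\<close>, so \<open>\<nu>\<close>
    gets the weight that \<open>convex_alt\<close> gives to \<open>y\<close>.\<close>
  define \<rho> where "\<rho> = bind_pmf (bernoulli_pmf u) (\<lambda>b. if b then \<nu> else \<mu>)"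
  have pmf: "pmf \<rho> s = u * pmf \<nu> s + (1 - u) * pmf \<mu> s" for s
    using u by (simp add: \<rho>_def pmf_bind)
  have "set_pmf \<rho> \<subseteq> pure_profiles G"
    using \<mu> \<nu> by (auto simp: \<rho>_def correlated_equilibrium_def split: if_splits)
  moreover have "(\<Sum>r\<in>Pi\<^sub>E (UNIV - {i}) (strategies G).
      pmf \<rho> (r(i := a)) * (payoff G i (r(i := a)) - payoff G i (r(i := b)))) \<ge> 0"
    if "a \<in> strategies G i" "b \<in> strategies G i" for i a b
  proof -
    let ?S = "\<lambda>\<mu>. \<Sum>r\<in>Pi\<^sub>E (UNIV - {i}) (strategies G).
      pmf \<mu> (r(i := a)) * (payoff G i (r(i := a)) - payoff G i (r(i := b)))"
    have "?S \<rho> = u * ?S \<nu> + (1 - u) * ?S \<mu>"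
      unfolding pmf sum_distrib_left sum.distrib[symmetric]
      by (intro sum.cong refl) (simp add: algebra_simps)
    moreover have "0 \<le> ?S \<mu>" "0 \<le> ?S \<nu>"
      using \<mu>(2) \<nu>(2) that unfolding correlated_equilibrium_def by blast+
    ultimately show ?thesis using u by simp
  qed
  ultimately have "correlated_equilibrium G \<rho>" by (auto simp: correlated_equilibrium_def)
  moreover have "expected_payoff G i \<rho> = (1 - u) * expected_payoff G i \<mu> + u * expected_payoff G i \<nu>" for i
    unfolding expected_payoff_def pmf sum_distrib_left sum.distrib[symmetric]
    by (intro sum.cong refl) (simp add: algebra_simps)
  ultimately show "(1 - u) *\<^sub>R x + u *\<^sub>R y \<in> CEP G"
    unfolding CEP_def \<mu> \<nu> by (auto simp: vec_eq_iff intro!: exI[of _ \<rho>])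
qed

text \<open>Sum the constraints over all recommendations: ignoring the recommendation and always
  playing \<open>b\<close> does not pay.\<close>

lemma correlated_equilibrium_deviation:
  assumes "finite_game G" "correlated_equilibrium G \<mu>" "b \<in> strategies G i"
  shows "0 \<le> (\<Sum>s\<in>pure_profiles G. pmf \<mu> s * (payoff G i s - payoff G i (s(i := b))))"
  using assms by (simp add: sum_pure_profiles_split[of G _ i] correlated_equilibrium_def sum_nonneg)

text \<open>Here \<open>v\<close> is a reference payoff, accurate up to \<open>\<alpha>\<close> off
  an exceptional event \<open>E\<close> of probability at most \<open>\<theta>\<close>, and up to
  \<open>B\<close> everywhere.\<close>

lemma expected_payoff_estimate:
  assumes G: "finite_game G" and \<mu>: "set_pmf \<mu> \<subseteq> pure_profiles G"
    and E: "\<And>s. s \<in> pure_profiles G \<Longrightarrow> \<not> E s \<Longrightarrow> \<bar>payoff G i s - v s\<bar> \<le> \<alpha>"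
    and B: "\<And>s. s \<in> pure_profiles G \<Longrightarrow> \<bar>payoff G i s - v s\<bar> \<le> B"
    and "0 \<le> \<alpha>" and m: "(\<Sum>s\<in>pure_profiles G. pmf \<mu> s * of_bool (E s)) \<le> \<theta>" and "0 \<le> B"
  shows "\<bar>expected_payoff G i \<mu> - (\<Sum>s\<in>pure_profiles G. pmf \<mu> s * v s)\<bar> \<le> \<alpha> + B * \<theta>"
proof -
  have "\<bar>expected_payoff G i \<mu> - (\<Sum>s\<in>pure_profiles G. pmf \<mu> s * v s)\<bar>
      = \<bar>\<Sum>s\<in>pure_profiles G. pmf \<mu> s * (payoff G i s - v s)\<bar>"
    by (simp add: expected_payoff_def right_diff_distrib sum_subtractf)
  also have "\<dots> \<le> (\<Sum>s\<in>pure_profiles G. pmf \<mu> s * \<bar>payoff G i s - v s\<bar>)"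
    by (rule order_trans[OF sum_abs]) (simp add: abs_mult)
  also have "\<dots> \<le> (\<Sum>s\<in>pure_profiles G. pmf \<mu> s * (\<alpha> + B * of_bool (E s)))"
    using E B \<open>0 \<le> \<alpha>\<close> by (intro sum_mono mult_left_mono) (auto intro: add_increasing)
  also have "\<dots> = \<alpha> * (\<Sum>s\<in>pure_profiles G. pmf \<mu> s) + B * (\<Sum>s\<in>pure_profiles G. pmf \<mu> s * of_bool (E s))"
    unfolding sum_distrib_left sum.distrib[symmetric] by (intro sum.cong refl) (simp add: algebra_simps)
  also have "\<dots> \<le> \<alpha> + B * \<theta>"
    using m \<open>0 \<le> B\<close> sum_pmf_eq_1[OF finite_pure_profiles[OF G] \<mu>] by (simp add: mult_left_mono)
  finally show ?thesis .
qed

text \<open>Pure deviations suffice: against point masses a mixed deviation earns an average of what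
  the pure ones earn.\<close>

lemma pure_nash_equilibrium:
  assumes G: "finite_game G" and s: "s \<in> pure_profiles G"
    and le: "\<And>i a. a \<in> strategies G i \<Longrightarrow> payoff G i (s(i := a)) \<le> payoff G i s"
  shows "(\<chi> i. payoff G i s) \<in> NEP G"
proof -
  let ?\<sigma> = "\<lambda>i. return_pmf (s i)"
  have si: "s i \<in> strategies G i" for i using s by (auto simp: pure_profiles_def)
  have fin: "finite (strategies G i)" for i using G by (auto simp: finite_game_def)
  have dev: "deviation_payoff G ?\<sigma> i a = payoff G i (s(i := a))" for i a
  proof -
    let ?R = "Pi\<^sub>E (UNIV - {i}) (strategies G)" and ?r = "restrict s (UNIV - {i})"
    have r: "?r \<in> ?R" using si by auto
    have "(\<Prod>j\<in>UNIV - {i}. pmf (?\<sigma> j) (r j)) = of_bool (r = ?r)" if "r \<in> ?R" for r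
    proof (cases "r = ?r")
      case False
      then obtain j where j: "r j \<noteq> ?r j" by (auto simp: fun_eq_iff)
      then have "j \<noteq> i" using PiE_arb[OF that, of i] by auto
      then have "(\<Prod>j\<in>UNIV - {i}. pmf (?\<sigma> j) (r j)) = 0" using j by (auto intro!: prod_zero bexI[of _ j])
      then show ?thesis using False by simp
    qed auto
    then have "deviation_payoff G ?\<sigma> i a = (\<Sum>r\<in>?R. if r = ?r then payoff G i (r(i := a)) else 0)"
      unfolding deviation_payoff_def by (intro sum.cong refl) auto
    also have "\<dots> = payoff G i (?r(i := a))"
      using r finite_profiles_except[OF G] by simp
    also have "?r(i := a) = s(i := a)" by auto
    finally show ?thesis .
  qed
  have E: "expected_payoff G i (product_distribution (?\<sigma>(i := \<tau>))) =
      (\<Sum>a\<in>strategies G i. pmf \<tau> a * payoff G i (s(i := a)))" for i \<tau>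
    by (simp add: expected_payoff_deviation[OF G] dev)
  have E0: "expected_payoff G i (product_distribution ?\<sigma>) = payoff G i s" for i
  proof -
    have "(\<Sum>a\<in>strategies G i. pmf (return_pmf (s i)) a * payoff G i (s(i := a)))
        = (\<Sum>a\<in>strategies G i. if a = s i then payoff G i s else 0)"
      by (intro sum.cong refl) (auto simp: pmf_return)
    also have "\<dots> = payoff G i s" using si fin by simp
    finally show ?thesis using E[of i "return_pmf (s i)"] by (simp add: fun_upd_idem)
  qed
  have "nash_equilibrium G ?\<sigma>"
    unfolding nash_equilibrium_def
  proof (intro conjI allI impI)
    fix i \<tau> assume \<tau>: "set_pmf \<tau> \<subseteq> strategies G i"
    have "(\<Sum>a\<in>strategies G i. pmf \<tau> a * payoff G i (s(i := a)))
        \<le> (\<Sum>a\<in>strategies G i. pmf \<tau> a * payoff G i s)"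
      using le by (intro sum_mono mult_left_mono) auto
    also have "\<dots> = payoff G i s"
      using sum_pmf_eq_1[OF fin \<tau>] by (simp flip: sum_distrib_right)
    finally show "expected_payoff G i (product_distribution (?\<sigma>(i := \<tau>)))
        \<le> expected_payoff G i (product_distribution ?\<sigma>)"
      by (simp add: E E0)
  qed (use si in auto)
  then show ?thesis unfolding NEP_def using E0 by (auto intro!: exI[of _ ?\<sigma>])
qed

lemma product_distribution_profiles:
  assumes "\<And>i. set_pmf (\<sigma> i) \<subseteq> strategies G i"
  shows "set_pmf (product_distribution \<sigma>) \<subseteq> pure_profiles G"
proof
  fix s assume "s \<in> set_pmf (product_distribution \<sigma>)"
  then have "pmf (\<sigma> j) (s j) \<noteq> 0" for j
    by (auto simp: set_pmf_iff pmf_product_distribution)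
  then show "s \<in> pure_profiles G" using assms by (auto simp: pure_profiles_def PiE_def set_pmf_iff subset_iff)
qed

subsection \<open>The relative game\<close>

text \<open>A strategy is coded as \<open>6 * level + kind\<close>; each level has room for the six
  kinds of a block.\<close>

definition level :: "nat \<Rightarrow> nat" where "level s = s div 6"

definition kind :: "nat \<Rightarrow> nat" where "kind s = s mod 6"

lemma level_kind_eqI: "level s = level t \<Longrightarrow> kind s = kind t \<Longrightarrow> s = t"
  unfolding level_def kind_def by (metis mult_div_mod_eq)

lemma level_add [simp]: "j < 6 \<Longrightarrow> level (6 * k + j) = k"
  and kind_add [simp]: "j < 6 \<Longrightarrow> kind (6 * k + j) = j"
  and level_mult [simp]: "level (6 * k) = k"
  and kind_mult [simp]: "kind (6 * k) = 0"
  and level_0 [simp]: "level 0 = 0"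
  and kind_0 [simp]: "kind 0 = 0"
  by (auto simp: level_def kind_def)

text \<open>Levels below \<open>m\<close> are meant for the points of \<open>U\<close>, those from
  \<open>m\<close> up to \<open>N - 1\<close> for the blocks. The bound on \<delta> makes a loss of
  1 outweigh the gains of order \<delta>.\<close>

locale level_game =
  fixes m N :: nat and \<delta> :: real
  assumes m_pos: "0 < m" and m_le: "m \<le> N" and \<delta>_pos: "0 < \<delta>" and \<delta>_small: "\<delta> \<le> 1 / 100"
begin

definition S :: "nat set" where
  "S = {s. level s < N \<and> (level s < m \<longrightarrow> kind s = 0)}"

text \<open>
  Below level \<open>m\<close> only kind 0 occurs. In a block, kinds 0 to 2 are the basic strategies, and
  kind \<open>j + 3\<close> bets that the opponent plays kind \<open>j\<close>.
\<close>

definition f :: "nat \<Rightarrow> nat \<Rightarrow> real" where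
  "f s t = (if level t < level s then -1
    else if level s < level t then -\<delta>
    else if level s < m then 0
    else if 3 \<le> kind t \<or> kind s = kind t then -1
    else if kind s < 3 then 0
    else if kind s = kind t + 3 then 4 * \<delta>
    else -1)"

definition F :: "nat \<Rightarrow> nat pmf \<Rightarrow> real" where
  "F s y = (\<Sum>t\<in>S. pmf y t * f s t)"

definition bad :: "nat \<Rightarrow> nat pmf \<Rightarrow> real" where
  "bad s y = (\<Sum>t\<in>S. pmf y t * of_bool (f s t = -1))"

text \<open>
  \<open>best x y\<close> leaves the slack \<open>\<delta> / 4\<close> because an equilibrium of a perturbed game is only an
  approximate one of the relative game.
\<close>

definition best :: "nat pmf \<Rightarrow> nat pmf \<Rightarrow> bool" where
  "best x y \<longleftrightarrow> (\<forall>s\<in>set_pmf x. \<forall>s'\<in>S. F s' y \<le> F s y + \<delta> / 4)"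

lemma finite_S: "finite S"
proof (rule finite_subset)
  show "S \<subseteq> {..<6 * N}" unfolding S_def level_def by auto
qed simp

lemma zero_in_S: "0 \<in> S" using m_pos m_le by (simp add: S_def)

lemma sum_pmf_of_bool: "c \<in> S \<Longrightarrow> (\<Sum>t\<in>S. pmf y t * of_bool (t = c)) = pmf y c"
  using finite_S by (simp add: of_bool_def if_distrib cong: if_cong)

lemma f_le: "f s t \<le> 4 * \<delta>" and f_ge: "-1 \<le> f s t"
  using \<delta>_pos \<delta>_small by (auto simp: f_def)

text \<open>Level 0 lies below \<open>m\<close>: nobody is beneath it, and meeting there pays 0.
  This is the safe fallback of both players.\<close>

lemma f_zero_ge: "t \<in> S \<Longrightarrow> -\<delta> \<le> f 0 t"
  using \<delta>_pos m_pos by (auto simp: f_def S_def)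

text \<open>At different levels the higher player loses 1. At equal levels the only entry besides 0
  and -1 is a won bet, and there the opponent loses 1.\<close>

lemma not_bad_cell:
  assumes "s \<in> S" "t \<in> S" "f s t \<noteq> -1" "f t s \<noteq> -1"
  shows "level s = level t" "f s t = 0"
  using assms \<delta>_small by (auto simp: f_def S_def split: if_splits)

section \<open>Loss probabilities under approximate best replies\<close>

lemma F_le:
  assumes "set_pmf y \<subseteq> S" "\<And>t. t \<in> set_pmf y \<Longrightarrow> f s t \<le> g" "0 \<le> g"
  shows "F s y \<le> g - bad s y"
proof -
  \<comment> \<open>Where the loss occurs, \<open>f s t\<close> is -1, which is at most
    \<open>g - 1\<close>.\<close>
  have "F s y \<le> (\<Sum>t\<in>S. pmf y t * (g - of_bool (f s t = -1)))"
    unfolding F_def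
  proof (intro sum_mono)
    fix t show "pmf y t * f s t \<le> pmf y t * (g - of_bool (f s t = -1))"
      using assms(2)[of t] \<open>0 \<le> g\<close>
      by (cases "t \<in> set_pmf y") (auto simp: set_pmf_iff intro!: mult_left_mono)
  qed
  also have "\<dots> = g - bad s y"
    using sum_pmf_eq_1[OF finite_S assms(1)]
    by (simp add: bad_def right_diff_distrib sum_subtractf flip: sum_distrib_right)
  finally show ?thesis .
qed

text \<open>Compare with strategy 0, which earns at least -\<delta>; the remaining \<delta>/4 is the
  slack of \<open>best\<close>.\<close>

lemma F_best_ge:
  assumes "set_pmf y \<subseteq> S" "best x y" "s \<in> set_pmf x"
  shows "- (5 / 4) * \<delta> \<le> F s y"
proof -
  have "-\<delta> = (\<Sum>t\<in>S. pmf y t * (-\<delta>))"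
    unfolding sum_distrib_right[symmetric] using sum_pmf_eq_1[OF finite_S assms(1)] by simp
  also have "\<dots> \<le> F 0 y"
    unfolding F_def by (intro sum_mono mult_left_mono f_zero_ge) auto
  finally have "-\<delta> \<le> F 0 y" .
  then show ?thesis using assms(2,3) zero_in_S unfolding best_def by fastforce
qed

text \<open>No entry of \<open>f\<close> exceeds 4\<delta>, so the loss probability is at most (4 +
  5/4)\<delta>, rounded up.\<close>

lemma bad_le:
  assumes "set_pmf y \<subseteq> S" "best x y" "s \<in> set_pmf x"
  shows "bad s y \<le> 6 * \<delta>"
  using F_best_ge[OF assms] F_le[OF assms(1), of s "4 * \<delta>"] f_le \<delta>_pos by simp

text \<open>A basic strategy of a block never wins, so the 4\<delta> of \<open>bad_le\<close>
  disappears. The constant matters: two such bounds add up to the threshold in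
  \<open>not_concentrated\<close>.\<close>

lemma bad_le_level:
  assumes "set_pmf y \<subseteq> S" "best x y" "s \<in> set_pmf x"
    and "m \<le> level s" "kind s < 3"
  shows "bad s y \<le> 5 / 4 * \<delta>"
proof -
  have "f s t \<le> 0" for t using assms(4,5) \<delta>_pos by (auto simp: f_def)
  then show ?thesis using F_best_ge[OF assms(1-3)] F_le[OF assms(1), of s 0] by simp
qed

lemma ex_not_bad:
  assumes "set_pmf y \<subseteq> S" "best x y" "s \<in> set_pmf x"
  obtains t where "t \<in> set_pmf y" "f s t \<noteq> -1"
proof (rule ccontr)
  assume "\<not> thesis"
  then have "pmf y t * of_bool (f s t = -1) = pmf y t" for t
    using that by (cases "t \<in> set_pmf y") (auto simp: set_pmf_iff)
  then have "bad s y = (\<Sum>t\<in>S. pmf y t)" unfolding bad_def by (intro sum.cong refl)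
  then have "bad s y = 1" using sum_pmf_eq_1[OF finite_S assms(1)] by simp
  then show False using bad_le[OF assms] \<delta>_small by simp
qed

text \<open>Union bound: once the losses of \<open>s\<close> and of \<open>s'\<close> are removed,
  only \<open>c\<close> remains. The case \<open>s' = s\<close> is also used.\<close>

lemma pmf_ge_of_not_bad:
  assumes y: "set_pmf y \<subseteq> S" and "c \<in> S"
    and "\<And>t. t \<in> set_pmf y \<Longrightarrow> f s t \<noteq> -1 \<Longrightarrow> f s' t \<noteq> -1 \<Longrightarrow> t = c"
  shows "1 - bad s y - bad s' y \<le> pmf y c"
proof -
  have "1 - bad s y - bad s' y
      = (\<Sum>t\<in>S. pmf y t * (1 - of_bool (f s t = -1) - of_bool (f s' t = -1)))"
    using sum_pmf_eq_1[OF finite_S y] by (simp add: bad_def right_diff_distrib sum_subtractf)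
  also have "\<dots> \<le> (\<Sum>t\<in>S. pmf y t * of_bool (t = c))"
  proof (intro sum_mono)
    fix t show "pmf y t * (1 - of_bool (f s t = -1) - of_bool (f s' t = -1)) \<le> pmf y t * of_bool (t = c)"
      using assms(3)[of t] by (cases "t \<in> set_pmf y") (auto simp: set_pmf_iff intro!: mult_left_mono)
  qed
  also have "\<dots> = pmf y c" using \<open>c \<in> S\<close> by (rule sum_pmf_of_bool)
  finally show ?thesis .
qed

text \<open>The bet \<open>c + 3\<close> wins 4\<delta> on \<open>c\<close> and loses at most 1
  elsewhere, while the basic strategy \<open>s\<close> earns at most 0. Were \<open>y\<close> so
  concentrated, the bet would beat \<open>s\<close> by more than the slack.\<close>

lemma not_concentrated:
  assumes y: "set_pmf y \<subseteq> S" and b: "best x y" and s: "s \<in> set_pmf x" "m \<le> level s" "kind s < 3"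
    and c: "c \<in> S" "m \<le> level c" "kind c < 3"
  shows "pmf y c < 1 - 5 / 2 * \<delta>"
proof (rule ccontr)
  assume "\<not> ?thesis"
  then have p: "1 - pmf y c \<le> 5 / 2 * \<delta>" by simp
  have dm: "level (c + 3) = level c" "kind (c + 3) = kind c + 3" using c(3) unfolding level_def kind_def by presburger+
  have fc: "f (c + 3) c = 4 * \<delta>" using c dm by (simp add: f_def)
  have "c + 3 \<in> S" using c dm by (simp add: S_def)
  then have "F (c + 3) y \<le> F s y + \<delta> / 4" using b s by (auto simp: best_def)
  moreover have "F s y \<le> 0"
  proof -
    have "f s t \<le> 0" for t using s \<delta>_pos by (auto simp: f_def)
    then show ?thesis unfolding F_def by (intro sum_nonpos) (simp add: mult_nonneg_nonpos)
  qed
  moreover have "(4 * \<delta> + 1) * pmf y c - 1 \<le> F (c + 3) y"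
  proof -
    have "(4 * \<delta> + 1) * pmf y c - 1
        = (4 * \<delta> + 1) * (\<Sum>t\<in>S. pmf y t * of_bool (t = c)) - (\<Sum>t\<in>S. pmf y t)"
      using sum_pmf_of_bool[OF \<open>c \<in> S\<close>] sum_pmf_eq_1[OF finite_S y] by simp
    also have "\<dots> = (\<Sum>t\<in>S. pmf y t * ((4 * \<delta> + 1) * of_bool (t = c) - 1))"
      unfolding sum_distrib_left sum_subtractf[symmetric]
      by (intro sum.cong refl) (simp add: algebra_simps)
    also have "\<dots> \<le> F (c + 3) y"
      unfolding F_def using fc f_ge by (intro sum_mono mult_left_mono) auto
    finally show ?thesis .
  qed
  \<comment> \<open>As \<open>1 - pmf y c\<close> is at most 5/2 \<delta> and 4\<delta> at most
    4/100, the left side is at least 4\<delta> - 2.6\<delta>, more than \<delta>/4.\<close>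
  ultimately have "4 * \<delta> - (4 * \<delta> + 1) * (1 - pmf y c) \<le> \<delta> / 4" by (simp add: algebra_simps)
  moreover have "(4 * \<delta> + 1) * (1 - pmf y c) \<le> (4 / 100 + 1) * (5 / 2 * \<delta>)"
    using p \<delta>_pos \<delta>_small pmf_le_1[of y c] by (intro mult_mono) auto
  ultimately show False using \<delta>_pos by simp
qed

text \<open>Both supports reach the same highest level \<open>k\<close>, and a player there loses 1
  against everything lower. Below \<open>m\<close> this concentrates both players on
  \<open>6 * k\<close>; in a block it contradicts \<open>not_concentrated\<close>.\<close>

lemma best_imp_concentrated:
  assumes x: "set_pmf x \<subseteq> S" and y: "set_pmf y \<subseteq> S" and xy: "best x y" and yx: "best y x"
  obtains k where "k < m" "1 - 6 * \<delta> \<le> pmf x (6 * k)" "1 - 6 * \<delta> \<le> pmf y (6 * k)"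
proof -
  have finx: "finite (set_pmf x)" and finy: "finite (set_pmf y)"
    using x y finite_S finite_subset by blast+
  \<comment> \<open>A strategy above the whole support of the opponent would lose for sure.\<close>
  have up: "\<exists>t\<in>set_pmf v. level s \<le> level t"
    if "set_pmf v \<subseteq> S" "best u v" "s \<in> set_pmf u" for u v s
    using ex_not_bad[OF that] by (metis f_def not_less)
  define k where "k = Max ((\<lambda>s. level s) ` set_pmf x)"
  have kx: "level s \<le> k" if "s \<in> set_pmf x" for s
    using finx that by (auto simp: k_def)
  have "k \<in> (\<lambda>s. level s) ` set_pmf x"
    unfolding k_def using finx set_pmf_not_empty by (intro Max_in) auto
  then obtain s0 where s0: "s0 \<in> set_pmf x" "level s0 = k" by auto
  have ky: "level t \<le> k" if "t \<in> set_pmf y" for t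
    using up[OF x yx that] kx by force
  obtain t0 where t0: "t0 \<in> set_pmf y" "level t0 = k"
    using up[OF y xy s0(1)] ky s0(2) by force
  \<comment> \<open>Against \<open>v\<close>, which never goes above \<open>k\<close>, strategy
    \<open>s\<close> escapes the loss only at level \<open>k\<close>, whose single strategy is
    \<open>6 * k\<close>.\<close>
  have conc: "1 - 6 * \<delta> \<le> pmf v (6 * k)"
    if k: "k < m" and v: "set_pmf v \<subseteq> S" "best u v" "s \<in> set_pmf u" "level s = k"
      "\<And>t. t \<in> set_pmf v \<Longrightarrow> level t \<le> k" for u v s
  proof -
    have 1: "(\<Sum>t\<in>S. pmf v t * (1 - of_bool (f s t = -1))) = 1 - bad s v"
      using sum_pmf_eq_1[OF finite_S v(1)] by (simp add: bad_def right_diff_distrib sum_subtractf)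
    have in_S: "6 * k \<in> S" using k m_le by (simp add: S_def)
    have "pmf v t * (1 - of_bool (f s t = -1)) \<le> pmf v t * of_bool (t = 6 * k)" for t
    proof (cases "t \<in> set_pmf v \<and> f s t \<noteq> -1")
      case True
      then have "level t = k" using v(4) v(5)[of t] by (auto simp: f_def split: if_splits)
      moreover have "kind t = 0" using True v(1) k calculation by (auto simp: S_def)
      ultimately have "t = 6 * k" by (simp add: level_kind_eqI)
      then show ?thesis by simp
    next
      case False
      then show ?thesis by (auto simp: set_pmf_iff)
    qed
    then have "1 - bad s v \<le> (\<Sum>t\<in>S. pmf v t * of_bool (t = 6 * k))"
      unfolding 1[symmetric] by (intro sum_mono)
    also have "\<dots> = pmf v (6 * k)"
      using in_S by (rule sum_pmf_of_bool)
    finally show ?thesis using bad_le[OF v(1-3)] by simp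
  qed
  show thesis
  proof (cases "k < m")
    case True
    show thesis
      using that[OF True] conc[OF True x yx t0 kx] conc[OF True y xy s0 ky] by blast
  next
    case False
    \<comment> \<open>On a top level that is a block, the loss is escaped only against a basic
      strategy of another kind on that level.\<close>
    have good: "level t = k \<and> kind t < 3 \<and> kind t \<noteq> kind s"
      if "level s = k" "level t \<le> k" "f s t \<noteq> -1" for s t
      using that False by (auto simp: f_def split: if_splits)
    obtain s where s: "s \<in> set_pmf x" "level s = k" "kind s < 3"
      using ex_not_bad[OF x yx t0(1)] good t0(2) kx by metis
    obtain t where t: "t \<in> set_pmf y" "level t = k" "kind t < 3"
      using ex_not_bad[OF y xy s0(1)] good s0(2) ky by metis
    have lev: "m \<le> level s" "m \<le> level t" using s t False by auto
    have "s \<in> S" "t \<in> S" using s t x y by auto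
    then have kN: "k < N" using s by (auto simp: S_def)
    show thesis
    proof (cases "\<exists>s'\<in>set_pmf x. s' \<noteq> s \<and> level s' = k \<and> kind s' < 3")
      case True
      then obtain s' where s': "s' \<in> set_pmf x" "s' \<noteq> s" "level s' = k" "kind s' < 3" by auto
      have ne: "kind s \<noteq> kind s'" using s s' level_kind_eqI by auto
      \<comment> \<open>Kinds 0, 1, 2 sum to 3, so this is the third basic strategy, the only one
        against which both \<open>s\<close> and \<open>s'\<close> escape the loss; the subtraction
        does not truncate.\<close>
      define c where "c = 6 * k + (3 - kind s - kind s')"
      have c: "level c = k" "kind c = 3 - kind s - kind s'"
        by (simp_all add: c_def)
      have cS: "c \<in> S" using c kN False by (simp add: S_def)
      have "u = c" if u: "u \<in> set_pmf y" "f s u \<noteq> -1" "f s' u \<noteq> -1" for u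
      proof -
        have "level u = k \<and> kind u < 3 \<and> kind u \<noteq> kind s"
          by (rule good) (use s u ky in auto)
        moreover have "kind u \<noteq> kind s'"
          using good[of s' u] s' u ky by auto
        ultimately have "level u = level c" "kind u = kind c"
          using s s' c ne by auto
        then show ?thesis by (rule level_kind_eqI)
      qed
      then have "1 - bad s y - bad s' y \<le> pmf y c" by (intro pmf_ge_of_not_bad y cS)
      moreover have "bad s y \<le> 5 / 4 * \<delta>" "bad s' y \<le> 5 / 4 * \<delta>"
        using bad_le_level[OF y xy] s s' lev by auto
      moreover have "pmf y c < 1 - 5 / 2 * \<delta>"
        using not_concentrated[OF y xy s(1) lev(1) s(3) cS] c lev s ne by simp
      ultimately show thesis by simp
    next
      \<comment> \<open>Now \<open>s\<close> is the only basic strategy of \<open>x\<close> on the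
        top level, so \<open>t\<close> escapes the loss only against \<open>s\<close>; the union
        bound is applied with \<open>t\<close> twice.\<close>
      case False
      have "u = s" if u: "u \<in> set_pmf x" "f t u \<noteq> -1" for u
        using False good[of t u] t u kx by auto
      then have "1 - bad t x - bad t x \<le> pmf x s" by (intro pmf_ge_of_not_bad x \<open>s \<in> S\<close>) auto
      moreover have "bad t x \<le> 5 / 4 * \<delta>"
        using bad_le_level[OF x yx] t lev by auto
      moreover have "pmf x s < 1 - 5 / 2 * \<delta>"
        using not_concentrated[OF x yx t(1) lev(2) t(3) \<open>s \<in> S\<close> lev(1) s(3)] .
      ultimately show thesis by simp
    qed
  qed
qed

end

subsection \<open>The game and its perturbations\<close>

text \<open>\<open>i1\<close> and \<open>i2\<close> are the active players; \<open>w l\<close> is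
  the payoff vector attached to level \<open>l\<close>.\<close>

locale payoff_game = level_game m N \<delta> for m N \<delta> +
  fixes i1 i2 :: "'n::finite" and w :: "nat \<Rightarrow> real ^ 'n" and W :: real
  assumes i12: "i1 \<noteq> i2" and W_nonneg: "0 \<le> W"
    and w_le: "l < N \<Longrightarrow> \<bar>w l $ i\<bar> \<le> W"
begin

abbreviation active :: "'n \<Rightarrow> bool" where "active i \<equiv> i = i1 \<or> i = i2"

text \<open>An inactive player is assigned \<open>i1\<close>, so that \<open>pay\<close> reads the
  level of an active player in every case.\<close>

definition opp :: "'n \<Rightarrow> 'n" where "opp i = (if i = i1 then i2 else i1)"

definition strat :: "'n \<Rightarrow> nat set" where "strat i = (if active i then S else {0})"

text \<open>
  An active player's reference payoff depends only on the opponent's strategy, so that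
  incentives are determined by the relative payoff \<open>f\<close> alone.
\<close>

definition pay :: "'n \<Rightarrow> ('n \<Rightarrow> nat) \<Rightarrow> real" where
  "pay i s = w (level (s (opp i))) $ i + (if active i then f (s i) (s (opp i)) else 0)"

definition base_game :: "('n, nat) game" where
  "base_game = \<lparr>strategies = strat, payoff = \<lambda>i. restrict (pay i) (Pi\<^sub>E UNIV strat)\<rparr>"

definition prof :: "'n \<Rightarrow> nat \<Rightarrow> nat \<Rightarrow> 'n \<Rightarrow> nat" where
  "prof i a t = (\<lambda>j. if j = i then a else if j = opp i then t else 0)"

lemma opp: "active (opp i)" "active i \<Longrightarrow> opp i \<noteq> i" "active i \<Longrightarrow> opp (opp i) = i"
  using i12 by (auto simp: opp_def)

lemma active_cases: "active i \<Longrightarrow> active j \<Longrightarrow> j = i \<or> j = opp i"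
  using i12 by (auto simp: opp_def)

lemma prof_upd: "(prof i a t)(i := b) = prof i b t"
  by (auto simp: prof_def)

lemma pay_prof: "active i \<Longrightarrow> pay i (prof i a t) = w (level t) $ i + f a t"
  using opp[of i] by (auto simp: pay_def prof_def)

lemma prof_in: "active i \<Longrightarrow> a \<in> S \<Longrightarrow> t \<in> S \<Longrightarrow> prof i a t \<in> Pi\<^sub>E UNIV strat"
  using opp[of i] by (auto simp: prof_def strat_def dest: active_cases)

lemma level_less: "s \<in> S \<Longrightarrow> level s < N"
  by (simp add: S_def)

text \<open>Inactive players have only strategy 0, so the others' profile is determined by the
  opponent's strategy.\<close>

lemma sum_opponents:
  fixes h :: "('n \<Rightarrow> nat) \<Rightarrow> real"
  assumes "active i"
  shows "(\<Sum>r\<in>Pi\<^sub>E (UNIV - {i}) strat. h r) = (\<Sum>t\<in>S. h (restrict (prof i 0 t) (UNIV - {i})))"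
proof (rule sum.reindex_bij_witness
    [where i = "\<lambda>t. restrict (prof i 0 t) (UNIV - {i})" and j = "\<lambda>r. r (opp i)"])
  fix r assume r: "r \<in> Pi\<^sub>E (UNIV - {i}) strat"
  show "restrict (prof i 0 (r (opp i))) (UNIV - {i}) = r"
  proof
    fix j show "restrict (prof i 0 (r (opp i))) (UNIV - {i}) j = r j"
    proof (cases "j = i \<or> j = opp i")
      case False
      then have "\<not> active j" using active_cases[OF assms, of j] by auto
      then show ?thesis using r False by (auto simp: prof_def strat_def PiE_def Pi_def)
    next
      case True
      then show ?thesis using r opp[of i] assms by (auto simp: prof_def PiE_def extensional_def)
    qed
  qed
  then show "h (restrict (prof i 0 (r (opp i))) (UNIV - {i})) = h r" by simp
  show "r (opp i) \<in> S" using r opp[of i] assms by (auto simp: strat_def PiE_def Pi_def)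
next
  fix t assume "t \<in> S"
  then show "restrict (prof i 0 t) (UNIV - {i}) \<in> Pi\<^sub>E (UNIV - {i}) strat"
    using prof_in[OF assms zero_in_S, of t] by (auto simp: PiE_def)
  show "restrict (prof i 0 t) (UNIV - {i}) (opp i) = t"
    using opp(2)[OF assms] by (simp add: prof_def)
qed

lemma finite_base_game: "finite_game base_game"
  using zero_in_S finite_S by (auto simp: finite_game_def base_game_def strat_def pure_profiles_def)

lemma base_game_in_ball: "base_game \<in> game_ball base_game (\<delta> / 8)"
  using finite_base_game \<delta>_pos by (simp add: game_ball_def)

section \<open>Equilibrium payoffs of an arbitrary game in the ball\<close>

context
  fixes \<Gamma> assumes \<Gamma>: "\<Gamma> \<in> game_ball base_game (\<delta> / 8)"
begin

lemma fin: "finite_game \<Gamma>" and strategies_eq: "strategies \<Gamma> = strat"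
  using \<Gamma> by (auto simp: game_ball_def base_game_def)

lemma profiles_eq: "pure_profiles \<Gamma> = Pi\<^sub>E UNIV strat"
  by (simp add: pure_profiles_def strategies_eq)

lemma payoff_approx: "s \<in> pure_profiles \<Gamma> \<Longrightarrow> \<bar>payoff \<Gamma> i s - pay i s\<bar> \<le> \<delta> / 8"
  using \<Gamma> unfolding profiles_eq
  by (force simp: game_ball_def base_game_def pure_profiles_def intro: less_imp_le)

lemma profile_in_S: "s \<in> pure_profiles \<Gamma> \<Longrightarrow> active i \<Longrightarrow> s i \<in> S"
  unfolding profiles_eq by (auto simp: strat_def PiE_def Pi_def split: if_splits)

text \<open>W for the level vector, W for \<open>v\<close>, 1 for \<open>f\<close>; the perturbation
  is below the last 1.\<close>

lemma payoff_bound: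
  assumes "s \<in> pure_profiles \<Gamma>" "\<bar>v\<bar> \<le> W"
  shows "\<bar>payoff \<Gamma> i s - v\<bar> \<le> 2 * W + 2"
proof -
  have "\<bar>w (level (s (opp i))) $ i\<bar> \<le> W"
    using profile_in_S[OF assms(1) opp(1)] by (intro w_le level_less)
  moreover have "\<bar>if active i then f (s i) (s (opp i)) else 0\<bar> \<le> 1"
    using f_le[of "s i" "s (opp i)"] f_ge[of "s i" "s (opp i)"] \<delta>_small by auto
  ultimately show ?thesis
    using payoff_approx[OF assms(1), of i] assms(2) \<delta>_small unfolding pay_def by linarith
qed

lemma deviation_payoff_eq:
  assumes i: "active i" and \<sigma>: "\<And>j. set_pmf (\<sigma> j) \<subseteq> strat j"
  shows "deviation_payoff \<Gamma> \<sigma> i a = (\<Sum>t\<in>S. pmf (\<sigma> (opp i)) t * payoff \<Gamma> i (prof i a t))"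
proof -
  have "(\<Prod>j\<in>UNIV - {i}. pmf (\<sigma> j) (restrict (prof i 0 t) (UNIV - {i}) j)) = pmf (\<sigma> (opp i)) t" for t
  proof -
    have "(\<Prod>j\<in>UNIV - {i}. pmf (\<sigma> j) (restrict (prof i 0 t) (UNIV - {i}) j)) =
        pmf (\<sigma> (opp i)) t * (\<Prod>j\<in>UNIV - {i} - {opp i}. pmf (\<sigma> j) (restrict (prof i 0 t) (UNIV - {i}) j))"
      using opp[of i] i by (subst prod.remove[of _ "opp i"]) (auto simp: prof_def)
    also have "(\<Prod>j\<in>UNIV - {i} - {opp i}. pmf (\<sigma> j) (restrict (prof i 0 t) (UNIV - {i}) j)) = 1"
    proof (rule prod.neutral, rule ballI)
      fix j assume j: "j \<in> UNIV - {i} - {opp i}"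
      then have "\<not> active j" using active_cases[OF i, of j] by auto
      then have "set_pmf (\<sigma> j) \<subseteq> {0}" using \<sigma>[of j] by (simp add: strat_def)
      then have "\<sigma> j = return_pmf 0" by (simp add: set_pmf_subset_singleton)
      then show "pmf (\<sigma> j) (restrict (prof i 0 t) (UNIV - {i}) j) = 1"
        using j by (auto simp: prof_def)
    qed
    finally show ?thesis by simp
  qed
  moreover have "(restrict (prof i 0 t) (UNIV - {i}))(i := a) = prof i a t" for t
    by (auto simp: prof_def)
  ultimately show ?thesis
    unfolding deviation_payoff_def strategies_eq sum_opponents[OF i] by simp
qed

text \<open>The part \<open>K\<close> of the payoff depends on the opponent alone and cancels when
  two own strategies are compared; two errors of \<delta>/8 make up the slack of
  \<open>best\<close>.\<close>

lemma nash_best: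
  assumes ne: "nash_equilibrium \<Gamma> \<sigma>" and i: "active i"
  shows "best (\<sigma> i) (\<sigma> (opp i))"
  unfolding best_def
proof (intro ballI)
  fix a b assume a: "a \<in> set_pmf (\<sigma> i)" and b: "b \<in> S"
  have \<sigma>: "set_pmf (\<sigma> j) \<subseteq> strat j" for j
    using ne by (auto simp: nash_equilibrium_def strategies_eq)
  let ?y = "\<sigma> (opp i)" and ?V = "deviation_payoff \<Gamma> \<sigma> i"
  have y: "set_pmf ?y \<subseteq> S" using \<sigma>[of "opp i"] opp(1)[of i] by (simp add: strat_def)
  have aS: "a \<in> S" using a \<sigma>[of i] i by (auto simp: strat_def)
  define K where "K = (\<Sum>t\<in>S. pmf ?y t * w (level t) $ i)"
  have V: "\<bar>?V c - (K + F c ?y)\<bar> \<le> \<delta> / 8" if c: "c \<in> S" for c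
  proof -
    have "\<bar>?V c - (K + F c ?y)\<bar> = \<bar>\<Sum>t\<in>S. pmf ?y t * (payoff \<Gamma> i (prof i c t) - pay i (prof i c t))\<bar>"
      unfolding deviation_payoff_eq[OF i \<sigma>] K_def F_def sum.distrib[symmetric] sum_subtractf[symmetric] pay_prof[OF i]
      by (simp add: algebra_simps)
    also have "\<dots> \<le> (\<Sum>t\<in>S. pmf ?y t * \<bar>payoff \<Gamma> i (prof i c t) - pay i (prof i c t)\<bar>)"
      by (rule order_trans[OF sum_abs]) (simp add: abs_mult)
    also have "\<dots> \<le> (\<Sum>t\<in>S. pmf ?y t * (\<delta> / 8))"
      using prof_in[OF i c] by (intro sum_mono mult_left_mono payoff_approx) (auto simp: profiles_eq)
    also have "\<dots> = \<delta> / 8"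
      unfolding sum_distrib_right[symmetric] using sum_pmf_eq_1[OF finite_S y] by simp
    finally show ?thesis .
  qed
  have "?V b \<le> ?V a"
    using nash_equilibrium_best_reply[OF fin ne a] b i by (simp add: strategies_eq strat_def)
  then show "F b ?y \<le> F a ?y + \<delta> / 4" using V[OF b] V[OF aS] by linarith
qed

text \<open>Both active players play \<open>6 * k\<close> with probability at least 1 - 6\<delta>,
  so the joint profile has at least 1 - 12\<delta>. The total error \<delta>/8 + 24(W + 1)\<delta>
  is at most 25(W + 1)\<delta>.\<close>

lemma nash_payoff_near:
  assumes "x \<in> NEP \<Gamma>"
  obtains k where "k < m" "\<And>i. \<bar>x $ i - w k $ i\<bar> \<le> 25 * (W + 1) * \<delta>"
proof -
  obtain \<sigma> where x: "x = (\<chi> i. expected_payoff \<Gamma> i (product_distribution \<sigma>))"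
    and ne: "nash_equilibrium \<Gamma> \<sigma>" using assms by (auto simp: NEP_def)
  have \<sigma>: "set_pmf (\<sigma> j) \<subseteq> strat j" for j
    using ne by (auto simp: nash_equilibrium_def strategies_eq)
  have o: "opp i1 = i2" "opp i2 = i1" using i12 by (auto simp: opp_def)
  obtain k where k: "k < m" "1 - 6 * \<delta> \<le> pmf (\<sigma> i1) (6 * k)" "1 - 6 * \<delta> \<le> pmf (\<sigma> i2) (6 * k)"
    using best_imp_concentrated[of "\<sigma> i1" "\<sigma> i2"] \<sigma>[of i1] \<sigma>[of i2]
      nash_best[OF ne, of i1] nash_best[OF ne, of i2] by (auto simp: o strat_def)
  have kS: "6 * k \<in> S" using k m_le by (simp add: S_def)
  define z where "z = prof i1 (6 * k) (6 * k)"
  have z: "z \<in> pure_profiles \<Gamma>" unfolding profiles_eq z_def by (rule prof_in) (use kS in auto)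
  have "pmf (product_distribution \<sigma>) z = pmf (\<sigma> i1) (6 * k) * (pmf (\<sigma> i2) (6 * k) *
      (\<Prod>j\<in>UNIV - {i1} - {i2}. pmf (\<sigma> j) (z j)))"
    unfolding pmf_product_distribution
    using i12 by (subst prod.remove[of _ i1], simp, simp, subst prod.remove[of _ i2]) (auto simp: z_def prof_def o)
  also have "(\<Prod>j\<in>UNIV - {i1} - {i2}. pmf (\<sigma> j) (z j)) = 1"
  proof (rule prod.neutral, rule ballI)
    fix j assume j: "j \<in> UNIV - {i1} - {i2}"
    then have "set_pmf (\<sigma> j) \<subseteq> {0}" using \<sigma>[of j] by (auto simp: strat_def)
    then have "\<sigma> j = return_pmf 0" by (simp add: set_pmf_subset_singleton)
    then show "pmf (\<sigma> j) (z j) = 1" using j by (auto simp: z_def prof_def o)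
  qed
  finally have "(1 - 6 * \<delta>) * (1 - 6 * \<delta>) \<le> pmf (product_distribution \<sigma>) z"
    using k \<delta>_small by (simp add: mult_mono)
  moreover have "(1 - 6 * \<delta>) * (1 - 6 * \<delta>) = 1 - 12 * \<delta> + 36 * \<delta>\<^sup>2"
    by (simp add: algebra_simps power2_eq_square)
  ultimately have pz: "1 - 12 * \<delta> \<le> pmf (product_distribution \<sigma>) z"
    using zero_le_power2[of \<delta>] by linarith
  have sub: "set_pmf (product_distribution \<sigma>) \<subseteq> pure_profiles \<Gamma>"
    by (rule product_distribution_profiles) (simp add: strategies_eq \<sigma>)
  note tot = sum_pmf_eq_1[OF finite_pure_profiles[OF fin] sub]
  have "(\<Sum>s\<in>pure_profiles \<Gamma>. pmf (product_distribution \<sigma>) s * of_bool (s \<noteq> z))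
      = (\<Sum>s\<in>pure_profiles \<Gamma> - {z}. pmf (product_distribution \<sigma>) s)"
    using finite_pure_profiles[OF fin] by (intro sum.mono_neutral_cong_right) auto
  also have "\<dots> \<le> 12 * \<delta>"
    using tot pz z finite_pure_profiles[OF fin] by (simp add: sum_diff1)
  finally have mass: "(\<Sum>s\<in>pure_profiles \<Gamma>. pmf (product_distribution \<sigma>) s * of_bool (s \<noteq> z)) \<le> 12 * \<delta>" .
  have "\<bar>x $ i - w k $ i\<bar> \<le> 25 * (W + 1) * \<delta>" for i
  proof -
    have wk: "\<bar>w k $ i\<bar> \<le> W" using k m_le by (intro w_le) auto
    have "pay i z = w k $ i" using k i12 by (auto simp: pay_def z_def prof_def opp_def f_def)
    then have "\<bar>payoff \<Gamma> i s - w k $ i\<bar> \<le> \<delta> / 8" if "\<not> s \<noteq> z" for s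
      using payoff_approx[OF z, of i] that by simp
    then have "\<bar>expected_payoff \<Gamma> i (product_distribution \<sigma>) -
        (\<Sum>s\<in>pure_profiles \<Gamma>. pmf (product_distribution \<sigma>) s * w k $ i)\<bar> \<le> \<delta> / 8 + (2 * W + 2) * (12 * \<delta>)"
      using \<delta>_pos W_nonneg
      by (intro expected_payoff_estimate[OF fin sub _ _ _ mass] payoff_bound wk) auto
    also have "\<dots> \<le> 25 * (W + 1) * \<delta>"
      using \<delta>_pos W_nonneg by (simp add: algebra_simps)
    finally show ?thesis unfolding sum_distrib_right[symmetric] tot x by simp
  qed
  then show thesis using that k by blast
qed

text \<open>Always descending to 0 must not pay. Obeying instead gains at most 4\<delta> + \<delta>
  + \<delta>/4, and 1 less wherever the loss occurs.\<close>

lemma correlated_bad_mass: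
  assumes ce: "correlated_equilibrium \<Gamma> \<mu>" and i: "active i"
  shows "(\<Sum>s\<in>pure_profiles \<Gamma>. pmf \<mu> s * of_bool (f (s i) (s (opp i)) = -1)) \<le> 6 * \<delta>"
proof -
  have sub: "set_pmf \<mu> \<subseteq> pure_profiles \<Gamma>" using ce by (simp add: correlated_equilibrium_def)
  have "payoff \<Gamma> i s - payoff \<Gamma> i (s(i := 0)) \<le> 6 * \<delta> - of_bool (f (s i) (s (opp i)) = -1)"
    if s: "s \<in> pure_profiles \<Gamma>" for s
  proof -
    have s0: "s(i := 0) \<in> pure_profiles \<Gamma>"
      using s zero_in_S unfolding profiles_eq by (auto simp: strat_def PiE_def Pi_def split: if_splits)
    have "pay i s - pay i (s(i := 0)) = f (s i) (s (opp i)) - f 0 (s (opp i))"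
      using i opp[of i] by (auto simp: pay_def)
    moreover have "-\<delta> \<le> f 0 (s (opp i))"
      using profile_in_S[OF s opp(1)] by (rule f_zero_ge)
    moreover have "f (s i) (s (opp i)) \<le> 4 * \<delta> - of_bool (f (s i) (s (opp i)) = -1)"
      using f_le[of "s i" "s (opp i)"] \<delta>_pos by auto
    ultimately show ?thesis
      using payoff_approx[OF s, of i] payoff_approx[OF s0, of i] \<delta>_pos by linarith
  qed
  then have "(\<Sum>s\<in>pure_profiles \<Gamma>. pmf \<mu> s * (payoff \<Gamma> i s - payoff \<Gamma> i (s(i := 0))))
      \<le> (\<Sum>s\<in>pure_profiles \<Gamma>. pmf \<mu> s * (6 * \<delta> - of_bool (f (s i) (s (opp i)) = -1)))"
    by (intro sum_mono mult_left_mono) auto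
  also have "\<dots> = 6 * \<delta> - (\<Sum>s\<in>pure_profiles \<Gamma>. pmf \<mu> s * of_bool (f (s i) (s (opp i)) = -1))"
    using sum_pmf_eq_1[OF finite_pure_profiles[OF fin] sub]
    by (simp add: right_diff_distrib sum_subtractf flip: sum_distrib_right)
  finally show ?thesis
    using correlated_equilibrium_deviation[OF fin ce, of 0 i] zero_in_S i
    by (simp add: strategies_eq strat_def)
qed

lemma correlated_payoff_near:
  assumes "x \<in> CEP \<Gamma>" and P: "convex P" "\<And>l. l < N \<Longrightarrow> w l \<in> P"
  shows "\<exists>p\<in>P. \<forall>i. \<bar>x $ i - p $ i\<bar> \<le> 25 * (W + 1) * \<delta>"
proof -
  obtain \<mu> where x: "x = (\<chi> i. expected_payoff \<Gamma> i \<mu>)" and ce: "correlated_equilibrium \<Gamma> \<mu>"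
    using assms(1) by (auto simp: CEP_def)
  have sub: "set_pmf \<mu> \<subseteq> pure_profiles \<Gamma>" using ce by (simp add: correlated_equilibrium_def)
  have o: "opp i1 = i2" "opp i2 = i1" using i12 by (auto simp: opp_def)
  define E where "E s \<longleftrightarrow> f (s i1) (s i2) = -1 \<or> f (s i2) (s i1) = -1" for s :: "'n \<Rightarrow> nat"
  \<comment> \<open>Reading the level off \<open>i1\<close> alone gives a convex combination of the
    \<open>w l\<close>; outside \<open>E\<close> both active players share that level.\<close>
  define p where "p = (\<Sum>s\<in>pure_profiles \<Gamma>. pmf \<mu> s *\<^sub>R w (level (s i1)))"
  have "p \<in> P"
    unfolding p_def using P(1) sum_pmf_eq_1[OF finite_pure_profiles[OF fin] sub]
    by (intro convex_sum finite_pure_profiles[OF fin] P(2) level_less profile_in_S) auto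
  moreover have "\<bar>x $ i - p $ i\<bar> \<le> 25 * (W + 1) * \<delta>" for i
  proof -
    have "(\<Sum>s\<in>pure_profiles \<Gamma>. pmf \<mu> s * of_bool (E s))
        \<le> (\<Sum>s\<in>pure_profiles \<Gamma>. pmf \<mu> s * of_bool (f (s i1) (s i2) = -1) + pmf \<mu> s * of_bool (f (s i2) (s i1) = -1))"
      by (intro sum_mono) (auto simp: E_def)
    then have mass: "(\<Sum>s\<in>pure_profiles \<Gamma>. pmf \<mu> s * of_bool (E s)) \<le> 12 * \<delta>"
      using correlated_bad_mass[OF ce, of i1] correlated_bad_mass[OF ce, of i2]
      by (simp add: o sum.distrib)
    have good: "\<bar>payoff \<Gamma> i s - w (level (s i1)) $ i\<bar> \<le> \<delta> / 8"
      if s: "s \<in> pure_profiles \<Gamma>" "\<not> E s" for s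
    proof -
      have "s i1 \<in> S" "s i2 \<in> S" using profile_in_S[OF s(1)] by auto
      then have "level (s i1) = level (s i2)" "f (s i1) (s i2) = 0" "f (s i2) (s i1) = 0"
        using s(2) not_bad_cell[of "s i1" "s i2"] not_bad_cell(2)[of "s i2" "s i1"] by (simp_all add: E_def)
      then have "pay i s = w (level (s i1)) $ i"
        using i12 by (cases "i = i1"; cases "i = i2"; simp add: pay_def opp_def)
      then show ?thesis using payoff_approx[OF s(1), of i] by simp
    qed
    have "\<bar>expected_payoff \<Gamma> i \<mu> - (\<Sum>s\<in>pure_profiles \<Gamma>. pmf \<mu> s * w (level (s i1)) $ i)\<bar>
        \<le> \<delta> / 8 + (2 * W + 2) * (12 * \<delta>)"
    proof (rule expected_payoff_estimate[OF fin sub, where E = E])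
      fix s assume s: "s \<in> pure_profiles \<Gamma>" "\<not> E s"
      then show "\<bar>payoff \<Gamma> i s - w (level (s i1)) $ i\<bar> \<le> \<delta> / 8" by (rule good)
    next
      fix s assume s: "s \<in> pure_profiles \<Gamma>"
      have "s i1 \<in> S" by (rule profile_in_S[OF s]) simp
      then show "\<bar>payoff \<Gamma> i s - w (level (s i1)) $ i\<bar> \<le> 2 * W + 2"
        by (intro payoff_bound[OF s] w_le level_less)
    qed (use \<delta>_pos W_nonneg mass in simp_all)
    also have "\<dots> \<le> 25 * (W + 1) * \<delta>"
      using \<delta>_pos W_nonneg by (simp add: algebra_simps)
    finally show ?thesis by (simp add: x p_def sum_component)
  qed
  ultimately show ?thesis by blast
qed

text \<open>Let both active players use \<open>6 * k\<close>. Any other strategy lies on another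
  level and loses at least \<delta>, more than two errors of \<delta>/8 can recover.\<close>

lemma nash_payoff_exists:
  assumes k: "k < m"
  obtains x where "x \<in> NEP \<Gamma>" "\<And>i. \<bar>x $ i - w k $ i\<bar> \<le> \<delta>"
proof -
  have kS: "6 * k \<in> S" using k m_le by (simp add: S_def)
  define z where "z = prof i1 (6 * k) (6 * k)"
  have z: "z \<in> pure_profiles \<Gamma>" unfolding profiles_eq z_def by (rule prof_in) (use kS in auto)
  have z_eq: "z = prof i (6 * k) (6 * k)" if "active i" for i
    using that i12 by (auto simp: z_def prof_def opp_def fun_eq_iff)
  have "payoff \<Gamma> i (z(i := a)) \<le> payoff \<Gamma> i z" if a: "a \<in> strategies \<Gamma> i" for i a
  proof (cases "active i \<and> a \<noteq> 6 * k")
    case True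
    then have i: "active i" and aS: "a \<in> S" using a by (auto simp: strategies_eq strat_def)
    have za: "z(i := a) = prof i a (6 * k)" using z_eq[OF i] by (simp add: prof_upd)
    have zin: "z(i := a) \<in> pure_profiles \<Gamma>"
      unfolding za profiles_eq by (rule prof_in[OF i aS kS])
    have "pay i (z(i := a)) = w k $ i + f a (6 * k)" "pay i z = w k $ i + f (6 * k) (6 * k)"
      using pay_prof[OF i] z_eq[OF i] za by simp_all
    moreover have "f (6 * k) (6 * k) = 0" using k by (simp add: f_def)
    moreover have "f a (6 * k) \<le> -\<delta>"
    proof -
      have "level a \<noteq> k" using True aS k level_kind_eqI[of a "6 * k"] by (auto simp: S_def)
      then show ?thesis using \<delta>_small by (auto simp: f_def)
    qed
    ultimately show ?thesis
      using payoff_approx[OF zin, of i] payoff_approx[OF z, of i] \<delta>_pos by linarith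
  next
    case False
    have "z i = a"
    proof (cases "active i")
      case True
      then show ?thesis using False z_eq[of i] by (simp add: prof_def)
    next
      case False
      then show ?thesis using a by (auto simp: strategies_eq strat_def z_def prof_def opp_def)
    qed
    then have "z(i := a) = z" by auto
    then show ?thesis by simp
  qed
  then have "(\<chi> i. payoff \<Gamma> i z) \<in> NEP \<Gamma>" by (rule pure_nash_equilibrium[OF fin z])
  moreover have "\<bar>payoff \<Gamma> i z - w k $ i\<bar> \<le> \<delta>" for i
  proof -
    have "pay i z = w k $ i" using k i12 by (auto simp: pay_def z_def prof_def opp_def f_def)
    then show ?thesis using payoff_approx[OF z, of i] \<delta>_pos by simp
  qed
  ultimately show thesis using that by (metis vec_lambda_beta)
qed

text \<open>The equilibrium is uniform on ordered pairs of distinct basic strategies of level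
  \<open>l\<close>: a recommendation leaves the opponent uniform on the other two.\<close>

lemma correlated_payoff_exists:
  assumes l: "m \<le> l" "l < N"
  obtains x where "x \<in> CEP \<Gamma>" "\<And>i. \<bar>x $ i - w l $ i\<bar> \<le> \<delta>"
proof -
  define T where "T = {t. level t = l \<and> kind t < 3}"
  have T: "level t = l" "kind t < 3" if "t \<in> T" for t
    using that by (simp_all add: T_def)
  have T_eq: "T = {6 * l, 6 * l + 1, 6 * l + 2}"
  proof (intro equalityI subsetI)
    fix t assume "t \<in> T"
    then have "t = 6 * l + kind t" "kind t < 3" by (auto simp: T_def level_def kind_def)
    then show "t \<in> {6 * l, 6 * l + 1, 6 * l + 2}" by fastforce
  qed (auto simp: T_def simp del: add_2_eq_Suc' One_nat_def)
  have TS: "T \<subseteq> S" using T l by (auto simp: S_def)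
  have fT: "f s t = (if s = t then -1 else 0)" if "s \<in> T" "t \<in> T" for s t
    using T[OF that(1)] T[OF that(2)] l level_kind_eqI[of s t] by (auto simp: f_def)
  define Q where "Q = {s \<in> pure_profiles \<Gamma>. s i1 \<in> T \<and> s i2 \<in> T \<and> s i1 \<noteq> s i2}"
  have Q_prof: "prof i a t \<in> Q \<longleftrightarrow> a \<in> T \<and> t \<in> T \<and> a \<noteq> t" if "active i" for i a t
    using that i12 TS prof_in[OF that, of a t]
    by (auto simp: Q_def profiles_eq) (auto simp: prof_def opp_def)
  have "prof i1 (6 * l) (6 * l + 1) \<in> Q" by (subst Q_prof) (auto simp: T_eq)
  then have Q: "finite Q" "Q \<noteq> {}"
    using finite_pure_profiles[OF fin] by (auto simp: Q_def)
  then have cQ: "0 < card Q" by (simp add: card_gt_0_iff)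
  define \<mu> where "\<mu> = pmf_of_set Q"
  have sub: "set_pmf \<mu> \<subseteq> pure_profiles \<Gamma>" unfolding \<mu>_def using Q by (auto simp: Q_def)
  have pmf: "pmf \<mu> s = of_bool (s \<in> Q) / card Q" for s
    unfolding \<mu>_def using Q by (simp add: indicator_def)
  have "0 \<le> (\<Sum>r\<in>Pi\<^sub>E (UNIV - {i}) (strategies \<Gamma>).
      pmf \<mu> (r(i := a)) * (payoff \<Gamma> i (r(i := a)) - payoff \<Gamma> i (r(i := b))))" (is "0 \<le> ?C")
    if ab: "a \<in> strategies \<Gamma> i" "b \<in> strategies \<Gamma> i" for i a b
  proof (cases "active i \<and> a \<in> T \<and> a \<noteq> b")
    case True
    then have i: "active i" and a: "a \<in> T" and ne: "b \<noteq> a" and bS: "b \<in> S"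
      using ab by (auto simp: strategies_eq strat_def)
    define D where "D t = payoff \<Gamma> i (prof i a t) - payoff \<Gamma> i (prof i b t)" for t
    have upd: "(restrict (prof i 0 t) (UNIV - {i}))(i := c) = prof i c t" for c t
      by (auto simp: prof_def)
    have "?C = (\<Sum>t\<in>S. of_bool (t \<in> T \<and> a \<noteq> t) / card Q * D t)"
      unfolding strategies_eq sum_opponents[OF i] upd pmf D_def Q_prof[OF i] using a by simp
    also have "\<dots> = (\<Sum>t\<in>T - {a}. D t / card Q)"
      using finite_S TS by (intro sum.mono_neutral_cong_right) auto
    also have "\<dots> = (\<Sum>t\<in>T - {a}. D t) / card Q" by (simp add: sum_divide_distrib)
    finally have C: "?C = (\<Sum>t\<in>T - {a}. D t) / card Q" .
    obtain t1 t2 where t: "T - {a} = {t1, t2}" "t1 \<noteq> t2"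
    proof -
      consider "T - {a} = {6 * l, 6 * l + 1}" | "T - {a} = {6 * l, 6 * l + 2}"
        | "T - {a} = {6 * l + 1, 6 * l + 2}"
        using a unfolding T_eq by fastforce
      then show thesis by cases (use that in auto)
    qed
    have tT: "t1 \<in> T" "t2 \<in> T" "t1 \<noteq> a" "t2 \<noteq> a" using t by blast+
    have D: "- f b t - \<delta> / 4 \<le> D t" if "t \<in> T" "t \<noteq> a" for t
    proof -
      have "prof i a t \<in> pure_profiles \<Gamma>" "prof i b t \<in> pure_profiles \<Gamma>"
        unfolding profiles_eq using prof_in[OF i] a that TS bS by auto
      then have "\<bar>payoff \<Gamma> i (prof i a t) - pay i (prof i a t)\<bar> \<le> \<delta> / 8"
        "\<bar>payoff \<Gamma> i (prof i b t) - pay i (prof i b t)\<bar> \<le> \<delta> / 8"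
        using payoff_approx by auto
      moreover have "f a t = 0" using fT[OF a that(1)] that by simp
      ultimately show ?thesis unfolding D_def pay_prof[OF i] by linarith
    qed
    \<comment> \<open>Another basic strategy hits the diagonal once, a bet wins at most once and
      loses 1 otherwise, descending costs 2\<delta>, rising 2. The bound covers the two errors of
      \<delta>/4 in \<open>D\<close>.\<close>
    have "f b t1 + f b t2 \<le> - \<delta> / 2"
    proof (cases "b \<in> T")
      case True
      then have "b = t1 \<or> b = t2" using t(1) ne by blast
      then show ?thesis using fT[OF True tT(1)] fT[OF True tT(2)] t(2) \<delta>_small by auto
    next
      case False
      have k: "kind t1 \<noteq> kind t2" using level_kind_eqI[of t1 t2] T tT t(2) by auto
      have "\<not> (level b = l \<and> kind b < 3)" using False by (simp add: T_def)
      then show ?thesis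
        using T[OF tT(1)] T[OF tT(2)] l k \<delta>_pos \<delta>_small by (auto simp: f_def)
    qed
    then have "0 \<le> (\<Sum>t\<in>T - {a}. D t)"
      using D[OF tT(1,3)] D[OF tT(2,4)] t(2) by (simp add: t(1))
    then show ?thesis using cQ unfolding C by simp
  next
    \<comment> \<open>Either \<open>a = b\<close>, as always for an inactive player, or
      \<open>a\<close> is never recommended.\<close>
    case False
    have "pmf \<mu> (r(i := a)) * (payoff \<Gamma> i (r(i := a)) - payoff \<Gamma> i (r(i := b))) = 0" for r
    proof (cases "a = b")
      case False
      then have "active i" using ab by (auto simp: strategies_eq strat_def split: if_splits)
      then have "a \<notin> T" using \<open>\<not> (active i \<and> a \<in> T \<and> a \<noteq> b)\<close> False by blast
      then have "r(i := a) \<notin> Q" using \<open>active i\<close> by (auto simp: Q_def)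
      then show ?thesis by (simp add: pmf)
    qed simp
    then have "?C = 0" by (intro sum.neutral ballI)
    then show ?thesis by simp
  qed
  then have ce: "correlated_equilibrium \<Gamma> \<mu>" using sub by (auto simp: correlated_equilibrium_def)
  have tot: "(\<Sum>s\<in>pure_profiles \<Gamma>. pmf \<mu> s) = 1"
    using sum_pmf_eq_1[OF finite_pure_profiles[OF fin] sub] .
  have mass: "(\<Sum>s\<in>pure_profiles \<Gamma>. pmf \<mu> s * of_bool (s \<notin> Q)) \<le> 0"
    by (intro sum_nonpos) (simp add: pmf)
  have "\<bar>expected_payoff \<Gamma> i \<mu> - w l $ i\<bar> \<le> \<delta>" for i
  proof -
    have "\<bar>payoff \<Gamma> i s - w l $ i\<bar> \<le> \<delta> / 8" if s: "s \<in> pure_profiles \<Gamma>" "\<not> s \<notin> Q" for s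
    proof -
      have "s i1 \<in> T" "s i2 \<in> T" "s i1 \<noteq> s i2" using s by (auto simp: Q_def)
      then have "pay i s = w l $ i" using fT T by (auto simp: pay_def opp_def)
      then show ?thesis using payoff_approx[OF s(1), of i] by simp
    qed
    then have "\<bar>expected_payoff \<Gamma> i \<mu> - (\<Sum>s\<in>pure_profiles \<Gamma>. pmf \<mu> s * w l $ i)\<bar>
        \<le> \<delta> / 8 + (2 * W + 2) * 0"
      using \<delta>_pos W_nonneg l
      by (intro expected_payoff_estimate[OF fin sub, where E = "\<lambda>s. s \<notin> Q"] payoff_bound w_le mass) auto
    then show ?thesis unfolding sum_distrib_right[symmetric] tot using \<delta>_pos by simp
  qed
  moreover have "(\<chi> i. expected_payoff \<Gamma> i \<mu>) \<in> CEP \<Gamma>" using ce by (auto simp: CEP_def)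
  ultimately show thesis using that by (metis vec_lambda_beta)
qed

end

end

section \<open>The maximum norm and the choice of parameters\<close>

lemma infnorm_le_cart: "(\<And>i. \<bar>x $ i\<bar> \<le> b) \<Longrightarrow> infnorm (x :: real ^ 'n) \<le> b"
  unfolding infnorm_cart by (intro cSup_least) auto

text \<open>This passes from the finitely many generators of \<open>P\<close> to all of
  \<open>P\<close>; the reason is the triangle inequality.\<close>

lemma convex_infnorm_neighbourhood:
  assumes "convex (C :: (real ^ 'n) set)"
  shows "convex {x. \<exists>q\<in>C. infnorm (q - x) < e}"
  unfolding convex_alt
proof (intro ballI allI impI)
  fix x y and u :: real
  assume "x \<in> {x. \<exists>q\<in>C. infnorm (q - x) < e}" "y \<in> {x. \<exists>q\<in>C. infnorm (q - x) < e}"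
    and u: "0 \<le> u \<and> u \<le> 1"
  then obtain p q where p: "p \<in> C" "infnorm (p - x) < e" and q: "q \<in> C" "infnorm (q - y) < e"
    by blast
  let ?z = "(1 - u) *\<^sub>R x + u *\<^sub>R y" and ?r = "(1 - u) *\<^sub>R p + u *\<^sub>R q"
  have "?r - ?z = (1 - u) *\<^sub>R (p - x) + u *\<^sub>R (q - y)" by (simp add: algebra_simps)
  then have "infnorm (?r - ?z) \<le> infnorm ((1 - u) *\<^sub>R (p - x)) + infnorm (u *\<^sub>R (q - y))"
    by (metis infnorm_triangle)
  also have "\<dots> = (1 - u) * infnorm (p - x) + u * infnorm (q - y)"
    using u by (simp add: infnorm_mul)
  also have "\<dots> < e"
    using u by (intro convex_bound_lt p q) auto
  finally have "infnorm (?r - ?z) < e" .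
  moreover have "?r \<in> C" using assms p q u unfolding convex_alt by blast
  ultimately show "?z \<in> {x. \<exists>q\<in>C. infnorm (q - x) < e}" by blast
qed

theorem proposition6:
  fixes U P :: "(real ^ 'n) set" and \<epsilon> :: real
  assumes "CARD('n) \<ge> 2"
    and "finite U" and "U \<noteq> {}"
    and "polytope P" and "U \<subseteq> P"
    and "\<epsilon> > 0"
  shows "\<exists>\<S> :: ('n, nat) game set.
           \<S> \<noteq> {} \<and> open_game_set \<S> \<and>
           (\<forall>\<Gamma>\<in>\<S>. eps_close \<epsilon> (NEP \<Gamma>) U \<and> eps_close \<epsilon> (CEP \<Gamma>) P)"
proof -
  obtain i1 i2 :: 'n where i12: "i1 \<noteq> i2"
    using assms(1) by (metis card_2_iff' ex_card finite_class.finite_UNIV subset_UNIV)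
  obtain V where V: "finite V" "P = convex hull V" using assms(4) by (auto simp: polytope_def)
  obtain us where us: "set us = U" using \<open>finite U\<close> finite_list by blast
  obtain vs where vs: "set vs = V" using \<open>finite V\<close> finite_list by blast
  \<comment> \<open>The points of \<open>U\<close> come first and occupy the levels below
    \<open>m\<close>; the generators of \<open>P\<close> follow.\<close>
  define w where "w l = (us @ vs) ! l" for l
  define m where "m = length us"
  define N where "N = length (us @ vs)"
  define W where "W = (\<Sum>x\<in>U \<union> V. norm x)"
  \<comment> \<open>The factor 50 halves \<epsilon> against the error 25(W + 1)\<delta>, which makes
    closeness strict.\<close>
  define \<delta> where "\<delta> = min (1 / 100) (\<epsilon> / (50 * (W + 1)))"
  have W0: "0 \<le> W" by (simp add: W_def sum_nonneg)
  have \<delta>: "0 < \<delta>" "\<delta> \<le> 1 / 100"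
    using W0 \<open>\<epsilon> > 0\<close> min.cobounded1[of "1 / 100" "\<epsilon> / (50 * (W + 1))"]
    unfolding \<delta>_def by (simp, blast)
  have w_mem: "w l \<in> U \<union> V" if "l < N" for l
    using that nth_mem[of l "us @ vs"] us vs by (auto simp: w_def N_def)
  have w_U: "w ` {..<m} = U" using us by (auto simp: w_def m_def nth_append in_set_conv_nth)
  have w_V: "V \<subseteq> w ` {m..<N}"
  proof
    fix v assume "v \<in> V"
    then obtain j where "j < length vs" "vs ! j = v" using vs by (metis in_set_conv_nth)
    then show "v \<in> w ` {m..<N}"
      by (intro image_eqI[of _ _ "m + j"]) (auto simp: w_def m_def N_def nth_append)
  qed
  interpret payoff_game m N \<delta> i1 i2 w W
  proof
    show "0 < m" using us \<open>U \<noteq> {}\<close> by (auto simp: m_def)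
    show "\<bar>w l $ i\<bar> \<le> W" if "l < N" for l i
    proof -
      have "norm (w l) \<le> W"
        unfolding W_def using w_mem[OF that] \<open>finite U\<close> V(1) by (intro member_le_sum) auto
      then show ?thesis using component_le_norm_cart[of "w l" i] by linarith
    qed
  qed (use i12 W0 \<delta> in \<open>auto simp: m_def N_def\<close>)
  have e: "25 * (W + 1) * \<delta> < \<epsilon>"
  proof -
    have "25 * (W + 1) * \<delta> \<le> 25 * (W + 1) * (\<epsilon> / (50 * (W + 1)))"
      using W0 by (intro mult_left_mono) (auto simp: \<delta>_def)
    also have "\<dots> < \<epsilon>" using W0 \<open>\<epsilon> > 0\<close> by (simp add: field_simps add_pos_nonneg)
    finally show ?thesis .
  qed
  have "\<delta> \<le> 25 * (W + 1) * \<delta>" using W0 \<delta> by (simp add: algebra_simps)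
  then have \<delta>e: "\<delta> < \<epsilon>" using e by simp
  have near: "infnorm (x - y) < \<epsilon>"
    if "\<And>i. \<bar>x $ i - y $ i\<bar> \<le> b" "b < \<epsilon>" for x y :: "real ^ 'n" and b
    using infnorm_le_cart[of "x - y" b] that by simp
  have wP: "w l \<in> P" if "l < N" for l
    using w_mem[OF that] \<open>U \<subseteq> P\<close> V(2) hull_subset[of V convex] by auto
  have main: "eps_close \<epsilon> (NEP \<Gamma>) U \<and> eps_close \<epsilon> (CEP \<Gamma>) P"
    if \<Gamma>: "\<Gamma> \<in> game_ball base_game (\<delta> / 8)" for \<Gamma>
  proof (intro conjI)
    show "eps_close \<epsilon> (NEP \<Gamma>) U"
      unfolding eps_close_def
    proof (intro conjI ballI)
      fix x assume "x \<in> NEP \<Gamma>"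
      then obtain k where "k < m" "\<And>i. \<bar>x $ i - w k $ i\<bar> \<le> 25 * (W + 1) * \<delta>"
        using nash_payoff_near[OF \<Gamma>] by blast
      then show "\<exists>u\<in>U. infnorm (x - u) < \<epsilon>" using w_U near[OF _ e] by blast
    next
      fix u assume "u \<in> U"
      then obtain k where "k < m" "u = w k" using w_U by auto
      then show "\<exists>x\<in>NEP \<Gamma>. infnorm (x - u) < \<epsilon>"
        using nash_payoff_exists[OF \<Gamma>] near[OF _ \<delta>e] by metis
    qed
    have "convex P" using V by (simp add: convex_convex_hull)
    \<comment> \<open>Generators suffice: the set on the right is convex because
      \<open>CEP \<Gamma>\<close> is.\<close>
    have "V \<subseteq> {p. \<exists>x\<in>CEP \<Gamma>. infnorm (x - p) < \<epsilon>}"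
    proof
      fix v assume "v \<in> V"
      then obtain l where "m \<le> l" "l < N" "v = w l" using w_V by fastforce
      then show "v \<in> {p. \<exists>x\<in>CEP \<Gamma>. infnorm (x - p) < \<epsilon>}"
        using correlated_payoff_exists[OF \<Gamma>] near[OF _ \<delta>e] by (metis (no_types, lifting) mem_Collect_eq)
    qed
    then have "P \<subseteq> {p. \<exists>x\<in>CEP \<Gamma>. infnorm (x - p) < \<epsilon>}"
      unfolding V(2) by (intro hull_minimal convex_infnorm_neighbourhood convex_CEP)
    moreover have "\<exists>p\<in>P. infnorm (x - p) < \<epsilon>" if x: "x \<in> CEP \<Gamma>" for x
    proof -
      obtain p where "p \<in> P" "\<forall>i. \<bar>x $ i - p $ i\<bar> \<le> 25 * (W + 1) * \<delta>"
        using correlated_payoff_near[OF \<Gamma> x \<open>convex P\<close> wP] by auto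
      then show ?thesis using near[OF _ e] by blast
    qed
    ultimately show "eps_close \<epsilon> (CEP \<Gamma>) P" unfolding eps_close_def by blast
  qed
  show ?thesis
  proof (intro exI conjI ballI)
    show "game_ball base_game (\<delta> / 8) \<noteq> {}" using base_game_in_ball by blast
    show "open_game_set (game_ball base_game (\<delta> / 8))" by (rule game_ball_open)
  qed (use main in blast)+
qed

end
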